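(* Let $G$ be a complex Lie group, let $\sigma:G\to G$ be an antiholomorphic involution, and let $H\subset G$ be a closed complex Lie subgroup. If there exists a $\sigma$-equivariant real structure on $X=G/H$ then $\sigma(H)$ and $H$ are conjugate by an inner automorphism of $G$. Conversely, if $\sigma(H)$ and $H$ are conjugate by an inner automorphism of $G$ and $H$ is self-normalizing (i.e. $N_G(H)=H$), then a $\sigma$-equivariant real structure on $X$ exists and is unique.
   Context: An antiholomorphic involution $\sigma:G\to G$ is an involutive automorphism of $G$ as a real Lie group which is antiholomorphic. A real structure on a complex manifold $X$ is an antiholomorphic involutive diffeomorphism $\mu:X\to X$. If $G$ acts holomorphically on $X$, a real structure $\mu$ is $\sigma$-equivariant if $\mu(g\cdot x)=\sigma(g)\cdot\mu(x)$ for all $g\in G$, $x\in X$. Here $G$ acts on $G/H$ by left translations. *)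

theory Defs
  imports "HOL-Analysis.Analysis" "HOL-Algebra.Group_Action" "HOL-Algebra.Left_Coset"
begin

text \<open>
  The sets \<open>S\<close> below are relatively open subsets of a complex-linear subspace \<open>E\<close> of
  \<open>complex ^ 'n\<close>, so that \<open>E\<close> plays the role of \<open>\<complex>\<^sup>d\<close> for an arbitrary \<open>d \<le> CARD('n)\<close>, including
  \<open>d = 0\<close>.  The derivative is taken within \<open>S\<close>; only its restriction to \<open>E\<close> is meaningful.
  Maps that are complex (anti)differentiable at every point of an open set are real analytic, so
  smoothness need not be demanded separately.
\<close>

definition complex_linear :: "(complex ^ 'n \<Rightarrow> complex ^ 'm) \<Rightarrow> bool" where
  "complex_linear D \<longleftrightarrow> (\<forall>u v. D (u + v) = D u + D v) \<and> (\<forall>c v. D (c *s v) = c *s D v)"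

definition complex_antilinear :: "(complex ^ 'n \<Rightarrow> complex ^ 'm) \<Rightarrow> bool" where
  "complex_antilinear D \<longleftrightarrow> (\<forall>u v. D (u + v) = D u + D v) \<and> (\<forall>c v. D (c *s v) = cnj c *s D v)"

definition cvec_holomorphic_on :: "(complex ^ 'n \<Rightarrow> complex ^ 'm) \<Rightarrow> (complex ^ 'n) set \<Rightarrow> bool" where
  "cvec_holomorphic_on f S \<longleftrightarrow>
     (\<forall>z\<in>S. \<exists>D. complex_linear D \<and> (f has_derivative D) (at z within S))"

definition cvec_antiholomorphic_on :: "(complex ^ 'n \<Rightarrow> complex ^ 'm) \<Rightarrow> (complex ^ 'n) set \<Rightarrow> bool" where
  "cvec_antiholomorphic_on f S \<longleftrightarrow>
     (\<forall>z\<in>S. \<exists>D. complex_antilinear D \<and> (f has_derivative D) (at z within S))"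

type_synonym ('a, 'n) chart = "'a set \<times> ('a \<Rightarrow> complex ^ 'n)"

record ('a, 'n::finite) complex_space =
  mtop :: "'a topology"
  charts :: "('a, 'n) chart set"

text \<open>
  The model space of a chart is recovered as the complex span of its image: a nonempty relatively
  open subset of a complex-linear subspace spans that subspace.
\<close>

fun model_space :: "('a, 'n::finite) chart \<Rightarrow> (complex ^ 'n) set" where
  "model_space (U, \<phi>) = vec.span (\<phi> ` U)"

fun chart_on :: "'a topology \<Rightarrow> ('a, 'n::finite) chart \<Rightarrow> bool" where
  "chart_on T (U, \<phi>) \<longleftrightarrow>
     openin T U \<and>
     openin (top_of_set (model_space (U, \<phi>))) (\<phi> ` U) \<and>
     homeomorphic_map (subtopology T U) (top_of_set (\<phi> ` U)) \<phi>"

fun compatible :: "('a, 'n::finite) chart \<Rightarrow> ('a, 'n) chart \<Rightarrow> bool" where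
  "compatible (U, \<phi>) (V, \<psi>) \<longleftrightarrow>
     cvec_holomorphic_on (\<psi> \<circ> inv_into U \<phi>) (\<phi> ` (U \<inter> V)) \<and>
     cvec_holomorphic_on (\<phi> \<circ> inv_into V \<psi>) (\<psi> ` (U \<inter> V))"

definition complex_manifold :: "('a, 'n::finite) complex_space \<Rightarrow> bool" where
  "complex_manifold M \<longleftrightarrow>
     Hausdorff_space (mtop M) \<and> second_countable (mtop M) \<and>
     (\<forall>c\<in>charts M. chart_on (mtop M) c) \<and>
     topspace (mtop M) = (\<Union>(U, \<phi>)\<in>charts M. U) \<and>
     (\<forall>c\<in>charts M. \<forall>d\<in>charts M. compatible c d)"

definition all_charts :: "('a, 'n::finite) complex_space \<Rightarrow> ('a, 'n) chart set" where
  "all_charts M = {c. chart_on (mtop M) c \<and> (\<forall>d\<in>charts M. compatible c d)}"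

definition holomorphic_map ::
  "('a, 'n::finite) complex_space \<Rightarrow> ('b, 'm::finite) complex_space \<Rightarrow> ('a \<Rightarrow> 'b) \<Rightarrow> bool" where
  "holomorphic_map M N f \<longleftrightarrow>
     continuous_map (mtop M) (mtop N) f \<and>
     (\<forall>(U, \<phi>)\<in>charts M. \<forall>(V, \<psi>)\<in>charts N.
        cvec_holomorphic_on (\<psi> \<circ> f \<circ> inv_into U \<phi>) (\<phi> ` (U \<inter> f -` V)))"

definition antiholomorphic_map ::
  "('a, 'n::finite) complex_space \<Rightarrow> ('b, 'm::finite) complex_space \<Rightarrow> ('a \<Rightarrow> 'b) \<Rightarrow> bool" where
  "antiholomorphic_map M N f \<longleftrightarrow>
     continuous_map (mtop M) (mtop N) f \<and>
     (\<forall>(U, \<phi>)\<in>charts M. \<forall>(V, \<psi>)\<in>charts N.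
        cvec_antiholomorphic_on (\<psi> \<circ> f \<circ> inv_into U \<phi>) (\<phi> ` (U \<inter> f -` V)))"

definition holomorphic_submersion ::
  "('a, 'n::finite) complex_space \<Rightarrow> ('b, 'm::finite) complex_space \<Rightarrow> ('a \<Rightarrow> 'b) \<Rightarrow> bool" where
  "holomorphic_submersion M N f \<longleftrightarrow>
     holomorphic_map M N f \<and>
     (\<forall>(U, \<phi>)\<in>charts M. \<forall>(V, \<psi>)\<in>charts N. \<forall>z\<in>\<phi> ` (U \<inter> f -` V).
        \<exists>D. complex_linear D \<and>
            ((\<psi> \<circ> f \<circ> inv_into U \<phi>) has_derivative D) (at z within \<phi> ` (U \<inter> f -` V)) \<and>
            D ` model_space (U, \<phi>) = model_space (V, \<psi>))"

fun prod_chart :: "('a, 'n::finite) chart \<Rightarrow> ('b, 'm::finite) chart \<Rightarrow> ('a \<times> 'b, 'n + 'm) chart" where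
  "prod_chart (U, \<phi>) (V, \<psi>) =
     (U \<times> V, \<lambda>(x, y). \<chi> i. case i of Inl j \<Rightarrow> \<phi> x $ j | Inr j \<Rightarrow> \<psi> y $ j)"

definition prod_manifold ::
  "('a, 'n::finite) complex_space \<Rightarrow> ('b, 'm::finite) complex_space \<Rightarrow> ('a \<times> 'b, 'n + 'm) complex_space" where
  "prod_manifold M N =
     \<lparr> mtop = prod_topology (mtop M) (mtop N),
       charts = {prod_chart c d | c d. c \<in> charts M \<and> d \<in> charts N} \<rparr>"

definition complex_submanifold :: "('a, 'n::finite) complex_space \<Rightarrow> 'a set \<Rightarrow> bool" where
  "complex_submanifold M S \<longleftrightarrow>
     S \<subseteq> topspace (mtop M) \<and>
     (\<forall>x\<in>S. \<exists>(U, \<phi>)\<in>all_charts M. \<exists>F. x \<in> U \<and> vec.subspace F \<and> \<phi> ` (U \<inter> S) = \<phi> ` U \<inter> F)"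

definition real_structure :: "('a, 'n::finite) complex_space \<Rightarrow> ('a \<Rightarrow> 'a) \<Rightarrow> bool" where
  "real_structure X \<rho> \<longleftrightarrow>
     antiholomorphic_map X X \<rho> \<and> (\<forall>x\<in>topspace (mtop X). \<rho> (\<rho> x) = x)"

definition complex_lie_group :: "('a, 'b) monoid_scheme \<Rightarrow> ('a, 'n::finite) complex_space \<Rightarrow> bool" where
  "complex_lie_group G M \<longleftrightarrow>
     Group.group G \<and> complex_manifold M \<and> topspace (mtop M) = carrier G \<and>
     holomorphic_map (prod_manifold M M) M (\<lambda>(x, y). x \<otimes>\<^bsub>G\<^esub> y) \<and>
     holomorphic_map M M (\<lambda>x. inv\<^bsub>G\<^esub> x)"

definition antiholomorphic_involution ::
  "('a, 'b) monoid_scheme \<Rightarrow> ('a, 'n::finite) complex_space \<Rightarrow> ('a \<Rightarrow> 'a) \<Rightarrow> bool" where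
  "antiholomorphic_involution G M \<sigma> \<longleftrightarrow>
     \<sigma> \<in> iso G G \<and> (\<forall>g\<in>carrier G. \<sigma> (\<sigma> g) = g) \<and> antiholomorphic_map M M \<sigma>"

definition closed_complex_lie_subgroup ::
  "('a, 'b) monoid_scheme \<Rightarrow> ('a, 'n::finite) complex_space \<Rightarrow> 'a set \<Rightarrow> bool" where
  "closed_complex_lie_subgroup G M H \<longleftrightarrow>
     subgroup H G \<and> closedin (mtop M) H \<and> complex_submanifold M H"

definition quotient_topology :: "'a topology \<Rightarrow> ('a \<Rightarrow> 'b) \<Rightarrow> 'b topology" where
  "quotient_topology T p =
     topology (\<lambda>W. W \<subseteq> p ` topspace T \<and> openin T {x \<in> topspace T. p x \<in> W})"

lemma openin_quotient_topology:
  "openin (quotient_topology T p) W \<longleftrightarrow>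
     W \<subseteq> p ` topspace T \<and> openin T {x \<in> topspace T. p x \<in> W}"
proof -
  have "istopology (\<lambda>W. W \<subseteq> p ` topspace T \<and> openin T {x \<in> topspace T. p x \<in> W})"
    unfolding istopology_def
  proof (intro conjI allI impI)
    fix A B
    assume A: "A \<subseteq> p ` topspace T \<and> openin T {x \<in> topspace T. p x \<in> A}"
      and B: "B \<subseteq> p ` topspace T \<and> openin T {x \<in> topspace T. p x \<in> B}"
    then show "A \<inter> B \<subseteq> p ` topspace T" by blast
    have "{x \<in> topspace T. p x \<in> A \<inter> B} = {x \<in> topspace T. p x \<in> A} \<inter> {x \<in> topspace T. p x \<in> B}"
      by blast
    then show "openin T {x \<in> topspace T. p x \<in> A \<inter> B}"
      using A B openin_Int[of T "{x \<in> topspace T. p x \<in> A}" "{x \<in> topspace T. p x \<in> B}"]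
      by simp
  next
    fix \<A>
    assume *: "\<forall>A\<in>\<A>. A \<subseteq> p ` topspace T \<and> openin T {x \<in> topspace T. p x \<in> A}"
    then show "\<Union>\<A> \<subseteq> p ` topspace T" by blast
    have "{x \<in> topspace T. p x \<in> \<Union>\<A>} = \<Union>((\<lambda>A. {x \<in> topspace T. p x \<in> A}) ` \<A>)"
      by blast
    moreover have "openin T (\<Union>((\<lambda>A. {x \<in> topspace T. p x \<in> A}) ` \<A>))"
      using * by (intro openin_Union) auto
    ultimately show "openin T {x \<in> topspace T. p x \<in> \<Union>\<A>}"
      by simp
  qed
  then show ?thesis
    unfolding quotient_topology_def by (simp add: topology_inverse')
qed

lemma topspace_quotient_topology [simp]: "topspace (quotient_topology T p) = p ` topspace T"
proof
  show "topspace (quotient_topology T p) \<subseteq> p ` topspace T"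
    using openin_quotient_topology[of T p "topspace (quotient_topology T p)"] by simp
  have "{x \<in> topspace T. p x \<in> p ` topspace T} = topspace T" by blast
  then have "openin (quotient_topology T p) (p ` topspace T)"
    by (simp add: openin_quotient_topology)
  then show "p ` topspace T \<subseteq> topspace (quotient_topology T p)"
    by (rule openin_subset)
qed

lemma quotient_map_quotient_topology: "quotient_map T (quotient_topology T p) p"
  by (auto simp: quotient_map_def openin_quotient_topology)

text \<open>
  \<open>G/H\<close> is the set of left cosets with the quotient topology and its unique complex structure for
  which the projection is a holomorphic submersion.  By uniqueness, any two atlases with this
  property are compatible, so their union is the maximal atlas of that structure.
\<close>

definition homogeneous_space ::
  "('a, 'b) monoid_scheme \<Rightarrow> ('a, 'n::finite) complex_space \<Rightarrow> 'a set \<Rightarrow> ('a set, 'n) complex_space" where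
  "homogeneous_space G M H =
     (let p = (\<lambda>g. g <#\<^bsub>G\<^esub> H); Q = quotient_topology (mtop M) p
      in \<lparr> mtop = Q,
           charts = \<Union>{A. complex_manifold \<lparr> mtop = Q, charts = A \<rparr> \<and>
                          holomorphic_submersion M \<lparr> mtop = Q, charts = A \<rparr> p} \<rparr>)"

lemma topspace_homogeneous_space:
  assumes "complex_lie_group G M"
  shows "topspace (mtop (homogeneous_space G M H)) = lcosets\<^bsub>G\<^esub> H"
  using assms by (auto simp: homogeneous_space_def complex_lie_group_def LCOSETS_def Let_def)

definition equivariant ::
  "('a, 'b) monoid_scheme \<Rightarrow> ('a \<Rightarrow> 'a) \<Rightarrow> ('x, 'n::finite) complex_space \<Rightarrow> ('a \<Rightarrow> 'x \<Rightarrow> 'x) \<Rightarrow> ('x \<Rightarrow> 'x) \<Rightarrow> bool" where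
  "equivariant G \<sigma> X act \<rho> \<longleftrightarrow>
     (\<forall>g\<in>carrier G. \<forall>x\<in>topspace (mtop X). \<rho> (act g x) = act (\<sigma> g) (\<rho> x))"

text \<open>A coset \<open>x\<close> is itself a set, so \<open><#\<close> applied to it is translation: \<open>g <# (a <# H) = (g \<otimes> a) <# H\<close>.\<close>

abbreviation left_translation :: "('a, 'b) monoid_scheme \<Rightarrow> 'a \<Rightarrow> 'a set \<Rightarrow> 'a set" where
  "left_translation G g x \<equiv> g <#\<^bsub>G\<^esub> x"

definition inner_automorphism :: "('a, 'b) monoid_scheme \<Rightarrow> 'a \<Rightarrow> 'a \<Rightarrow> 'a" where
  "inner_automorphism G a g = a \<otimes>\<^bsub>G\<^esub> g \<otimes>\<^bsub>G\<^esub> inv\<^bsub>G\<^esub> a"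

definition conjugate_by_inner :: "('a, 'b) monoid_scheme \<Rightarrow> 'a set \<Rightarrow> 'a set \<Rightarrow> bool" where
  "conjugate_by_inner G K H \<longleftrightarrow> (\<exists>a\<in>carrier G. K = inner_automorphism G a ` H)"

end

theory Submission
  imports Defs
begin

text \<open>
  Write \<open>p g = gH\<close>.  An equivariant involution \<open>\<rho>\<close> of \<open>G/H\<close> with \<open>\<rho> H = bH\<close> carries the stabiliser
  \<open>H\<close> of the base point to the stabiliser \<open>b H b\<^sup>-\<^sup>1\<close> of its image, so \<open>\<sigma> H = b H b\<^sup>-\<^sup>1\<close>; involutivity
  turns the evident inclusion into an equality (\<open>equivariant_involution_imp_conjugate\<close>).  Moreover
  \<open>\<rho> (gH) = \<sigma> g b H\<close>, so \<open>\<rho>\<close> is determined by \<open>bH\<close>.  If \<open>H\<close> is self-normalizing, \<open>bH\<close> is in turn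
  determined by \<open>b H b\<^sup>-\<^sup>1 = \<sigma> H\<close>, which is uniqueness.

  Conversely, if \<open>\<sigma> H = a H a\<^sup>-\<^sup>1\<close>, then \<open>gH \<mapsto> \<sigma> g a H\<close> is well defined and equivariant.  Its square is
  \<open>gH \<mapsto> g \<sigma>(a) a H\<close>, and \<open>\<sigma>(a) a\<close> normalizes \<open>H\<close> because applying \<open>\<sigma>\<close> to
  \<open>\<sigma> H = a H a\<^sup>-\<^sup>1\<close> gives \<open>H = (\<sigma>(a) a) H (\<sigma>(a) a)\<^sup>-\<^sup>1\<close>
  (\<open>involution_cocycle_mem_normalizer\<close>); so self-normalization makes it the identity.

  What remains is that this map \<open>f\<close> is antiholomorphic.  Its lift \<open>\<tau> g = \<sigma> g a\<close> is antiholomorphic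
  on \<open>G\<close>, and \<open>f \<circ> p = p \<circ> \<tau>\<close> with \<open>p\<close> a holomorphic submersion, so the point is that
  antiholomorphy descends along submersions (\<open>antiholomorphic_map_descends\<close>).  One would usually
  take local holomorphic sections of \<open>p\<close> from the implicit function theorem, but since complex
  differentiability is a pointwise condition, less is enough: near \<open>p z\<close> every point \<open>y\<close> has a preimage
  within distance \<open>O(|y - p z|)\<close> of \<open>z\<close>, which may vary with \<open>y\<close> in an arbitrary way.  Brouwer's fixed
  point theorem provides such preimages from the derivative of \<open>p\<close> at the single point \<open>z\<close> and
  continuity nearby (\<open>slice_point_over\<close>).
\<close>

section \<open>Differentiability descends along a submersion\<close>

text \<open>
  A solution \<open>w\<close> of \<open>h w = y\<close> is a fixed point of \<open>w \<mapsto> w + y - h w\<close>.  If \<open>h\<close> differs from a translation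
  by at most half the distance to \<open>x0\<close>, this map preserves the ball of radius \<open>2 |y - h x0|\<close> in \<open>E\<close>,
  so Brouwer's theorem applies.  The subspace \<open>E\<close> is there because model spaces of charts
  are subspaces of the ambient coordinate space.
\<close>

lemma slice_point_over:
  fixes h :: "'a::euclidean_space \<Rightarrow> 'a"
  assumes E: "subspace E" "x0 \<in> E" "y \<in> E" "h x0 \<in> E"
    and B: "E \<inter> cball x0 (2 * norm (y - h x0)) \<subseteq> S"
    and cont: "continuous_on S h" and range: "h ` S \<subseteq> E"
    and close: "\<And>w. w \<in> E \<inter> cball x0 (2 * norm (y - h x0)) \<Longrightarrow>
                  norm (h w - h x0 - (w - x0)) \<le> norm (w - x0) / 2"
  obtains w where "w \<in> E \<inter> cball x0 (2 * norm (y - h x0))" "h w = y"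
proof -
  let ?B = "E \<inter> cball x0 (2 * norm (y - h x0))"
  have "compact ?B"
    using closed_subspace[OF E(1)] by (simp add: closed_Int_compact)
  moreover have "convex ?B"
    using E(1) by (simp add: convex_Int subspace_imp_convex)
  moreover have "?B \<noteq> {}"
    using E(2) by force
  moreover have "continuous_on ?B (\<lambda>w. w + y - h w)"
    using cont B by (intro continuous_intros) (rule continuous_on_subset)
  moreover have "(\<lambda>w. w + y - h w) \<in> ?B \<rightarrow> ?B"
  proof
    fix w assume w: "w \<in> ?B"
    then have "h w \<in> E" using B range by blast
    then have "w + y - h w \<in> E"
      using w E by (simp add: subspace_add subspace_diff)
    moreover have "norm (w + y - h w - x0) \<le> norm (y - h x0) + norm (w - x0) / 2"
      using close[OF w] norm_triangle_ineq4[of "y - h x0" "h w - h x0 - (w - x0)"]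
      by (simp add: algebra_simps)
    then have "dist x0 (w + y - h w) \<le> 2 * norm (y - h x0)"
      using w by (simp add: dist_norm norm_minus_commute)
    ultimately show "w + y - h w \<in> ?B" by simp
  qed
  ultimately obtain w where "w \<in> ?B" "w + y - h w = w"
    using brouwer[of ?B "\<lambda>w. w + y - h w"] by blast
  moreover from this have "h w = y" by (simp add: algebra_simps)
  ultimately show ?thesis using that by blast
qed

text \<open>
  The case of a submersion restricted to a transversal slice, where source and target have the same
  dimension and the derivative of \<open>h\<close> is the identity.  Given \<open>y\<close>, a preimage \<open>w\<close> with
  \<open>|w - x0| \<le> 2 |y - h x0|\<close> satisfies \<open>y - h x0 = (w - x0) + o(|w - x0|)\<close>, so the expansion of
  \<open>F y = k w\<close> in \<open>w - x0\<close> is also an expansion in \<open>y - h x0\<close> with the same linear part.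
\<close>

lemma has_derivative_descends_slice:
  fixes h :: "'a::euclidean_space \<Rightarrow> 'a" and k :: "'a \<Rightarrow> 'b::real_normed_vector"
  assumes E: "subspace E" and S: "openin (top_of_set E) S" "x0 \<in> S"
    and cont: "continuous_on S h" and range: "h ` S \<subseteq> E"
    and h: "(h has_derivative h') (at x0 within S)" "\<And>v. v \<in> E \<Longrightarrow> h' v = v"
    and k: "(k has_derivative k') (at x0 within S)"
    and F: "\<And>w. w \<in> S \<Longrightarrow> F (h w) = k w"
  shows "(F has_derivative k') (at (h x0) within E)"
  unfolding has_derivative_within_alt
proof (intro conjI allI impI)
  show "bounded_linear k'" by (rule has_derivative_bounded_linear[OF k])
  then obtain K where K: "K > 0" "\<And>v. norm (k' v) \<le> norm v * K"
    using bounded_linear.pos_bounded by blast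
  interpret k': bounded_linear k' by fact
  fix e :: real assume e: "e > 0"
  \<comment> \<open>The total error below is at most \<open>\<eta> (1 + K) |w - x0| \<le> 2 \<eta> (1 + K) |y - h x0|\<close>.\<close>
  define \<eta> where "\<eta> = min (1/2) (e / (2 * (1 + K)))"
  have \<eta>: "\<eta> > 0" using e K by (simp add: \<eta>_def)
  have \<eta>_half: "\<eta> \<le> 1/2" unfolding \<eta>_def by (rule min.cobounded1)
  have "\<eta> * (2 * (1 + K)) \<le> e / (2 * (1 + K)) * (2 * (1 + K))"
    using K by (intro mult_right_mono) (auto simp: \<eta>_def)
  then have \<eta>e: "\<eta> * (2 * (1 + K)) \<le> e" using K by simp
  have SE: "S \<subseteq> E" using S(1) openin_imp_subset by blast
  then have x0E: "x0 \<in> E" "h x0 \<in> E" using S(2) range by auto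
  obtain r0 where r0: "r0 > 0" "ball x0 r0 \<inter> E \<subseteq> S"
    using S openin_contains_ball[of E S] by blast
  obtain r1 where r1: "r1 > 0" "\<And>w. w \<in> S \<Longrightarrow> norm (w - x0) < r1 \<Longrightarrow>
      norm (h w - h x0 - h' (w - x0)) \<le> \<eta> * norm (w - x0)"
    using h(1) \<eta> unfolding has_derivative_within_alt by blast
  obtain r2 where r2: "r2 > 0" "\<And>w. w \<in> S \<Longrightarrow> norm (w - x0) < r2 \<Longrightarrow>
      norm (k w - k x0 - k' (w - x0)) \<le> \<eta> * norm (w - x0)"
    using k \<eta> unfolding has_derivative_within_alt by blast
  define r where "r = min r0 (min r1 r2)"
  have r: "r > 0" using r0 r1 r2 by (simp add: r_def)
  show "\<exists>d>0. \<forall>y\<in>E. norm (y - h x0) < d \<longrightarrow>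
          norm (F y - F (h x0) - k' (y - h x0)) \<le> e * norm (y - h x0)"
  proof (intro exI[of _ "r/2"] conjI ballI impI)
    show "r / 2 > 0" using r by simp
    fix y assume y: "y \<in> E" "norm (y - h x0) < r / 2"
    let ?B = "E \<inter> cball x0 (2 * norm (y - h x0))"
    have nr: "norm (w - x0) < r" "w \<in> S" if "w \<in> ?B" for w
    proof -
      show n: "norm (w - x0) < r" using that y by (simp add: dist_norm norm_minus_commute)
      then show "w \<in> S" using that r0(2)
        by (auto simp: r_def dist_norm norm_minus_commute subset_iff)
    qed
    have hw: "norm (h w - h x0 - (w - x0)) \<le> \<eta> * norm (w - x0)" if "w \<in> ?B" for w
      using r1(2)[of w] nr[OF that] h(2)[of "w - x0"] that x0E E
      by (simp add: r_def subspace_diff)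
    have "norm (h w - h x0 - (w - x0)) \<le> norm (w - x0) / 2" if "w \<in> ?B" for w
      using hw[OF that] mult_right_mono[OF \<eta>_half norm_ge_zero[of "w - x0"]] by simp
    then obtain w where w: "w \<in> ?B" "h w = y"
      using slice_point_over[of E x0 y h S] E x0E y(1) nr(2) cont range by blast
    have yw: "norm (y - h x0 - (w - x0)) \<le> \<eta> * norm (w - x0)"
      using hw[OF w(1)] w(2) by simp
    have kw: "norm (k w - k x0 - k' (w - x0)) \<le> \<eta> * norm (w - x0)"
      using r2(2)[of w] nr[OF w(1)] by (simp add: r_def)
    have "F y - F (h x0) - k' (y - h x0)
        = (k w - k x0 - k' (w - x0)) - k' (y - h x0 - (w - x0))"
      using F[OF nr(2)[OF w(1)]] F[OF S(2)] w(2) by (simp add: k'.diff)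
    then have "norm (F y - F (h x0) - k' (y - h x0))
        \<le> norm (k w - k x0 - k' (w - x0)) + norm (k' (y - h x0 - (w - x0)))"
      by (metis norm_triangle_ineq4)
    also have "\<dots> \<le> \<eta> * norm (w - x0) + \<eta> * norm (w - x0) * K"
      using kw K(2)[of "y - h x0 - (w - x0)"] mult_right_mono[OF yw, of K] K(1) by linarith
    also have "\<dots> = \<eta> * (1 + K) * norm (w - x0)" by (simp add: algebra_simps)
    also have "\<dots> \<le> \<eta> * (1 + K) * (2 * norm (y - h x0))"
      using w(1) \<eta> K(1) by (intro mult_left_mono) (auto simp: dist_norm norm_minus_commute)
    also have "\<dots> = \<eta> * (2 * (1 + K)) * norm (y - h x0)" by simp
    also have "\<dots> \<le> e * norm (y - h x0)"
      by (intro mult_right_mono \<eta>e) simp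
    finally show "norm (F y - F (h x0) - k' (y - h x0)) \<le> e * norm (y - h x0)" .
  qed
qed

text \<open>
  A right inverse \<open>g\<close> of the derivative of \<open>P\<close> spans a slice \<open>w \<mapsto> z + g w\<close>, parametrised by \<open>E'\<close>, along
  which \<open>P\<close> has derivative the identity.
\<close>

lemma has_derivative_descends:
  fixes P :: "'a::real_normed_vector \<Rightarrow> 'b::euclidean_space" and Q :: "'a \<Rightarrow> 'c::real_normed_vector"
  assumes E: "subspace E" and E': "subspace E'"
    and S: "openin (top_of_set E) S" "z \<in> S"
    and cont: "continuous_on S P" and range: "P ` S \<subseteq> E'"
    and P: "(P has_derivative P') (at z within S)"
    and Q: "(Q has_derivative Q') (at z within S)"
    and g: "bounded_linear g" "g ` E' \<subseteq> E" "\<And>v. v \<in> E' \<Longrightarrow> P' (g v) = v"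
    and F: "\<And>w. w \<in> S \<Longrightarrow> F (P w) = Q w"
  shows "(F has_derivative (\<lambda>v. Q' (g v))) (at (P z) within E')"
proof -
  interpret g: bounded_linear g by fact
  let ?j = "\<lambda>w. z + g w"
  define S' where "S' = {w \<in> E'. ?j w \<in> S}"
  have zE: "z \<in> E" using S openin_imp_subset by blast
  have j: "?j ` S' \<subseteq> S" by (auto simp: S'_def)
  have "?j \<in> E' \<rightarrow> E" using g(2) zE E by (auto simp: subspace_add)
  moreover have "continuous_on E' ?j"
    by (intro continuous_intros g.continuous_on)
  moreover have "S' = E' \<inter> ?j -` S" by (auto simp: S'_def)
  ultimately have opS': "openin (top_of_set E') S'"
    using continuous_openin_preimage[of E' ?j E S] S(1) by simp
  have 0: "0 \<in> S'" using S(2) E' by (simp add: S'_def subspace_0 g.zero)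
  have dj: "(?j has_derivative g) (at 0 within S')"
    by (auto intro!: derivative_eq_intros g.has_derivative)
  have d1: "((\<lambda>w. P (?j w)) has_derivative (\<lambda>v. P' (g v))) (at 0 within S')"
    by (rule has_derivative_in_compose[OF dj]) (use P j in \<open>auto simp: g.zero intro: has_derivative_subset\<close>)
  have d2: "((\<lambda>w. Q (?j w)) has_derivative (\<lambda>v. Q' (g v))) (at 0 within S')"
    by (rule has_derivative_in_compose[OF dj]) (use Q j in \<open>auto simp: g.zero intro: has_derivative_subset\<close>)
  have c: "continuous_on S' (\<lambda>w. P (?j w))"
    by (rule continuous_on_compose2[OF cont _ j]) (intro continuous_intros g.continuous_on)
  have "(F has_derivative (\<lambda>v. Q' (g v))) (at (P (?j 0)) within E')"
    using has_derivative_descends_slice[OF E' opS' 0 c _ d1 _ d2, of F] g(3) F j range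
    by (auto simp: image_subset_iff)
  then show ?thesis by (simp add: g.zero)
qed

section \<open>Complex-linear maps and model spaces\<close>

lemma scaleR_eq_smult: "r *\<^sub>R v = complex_of_real r *s (v :: complex ^ 'n)"
  by (auto simp: vec_eq_iff vector_scaleR_component scaleR_conv_of_real[where 'a = complex])

lemma complex_linear_imp_bounded_linear:
  fixes D :: "complex ^ 'n \<Rightarrow> complex ^ 'm"
  assumes "complex_linear D" shows "bounded_linear D"
  using assms unfolding complex_linear_def
  by (intro linear_conv_bounded_linear[THEN iffD1] linearI) (auto simp: scaleR_eq_smult)

lemma subspace_model_space: "subspace (model_space c)"
  by (cases c) (auto intro!: subspaceI vec.span_zero vec.span_add
      simp: scaleR_eq_smult vec.span_scale)

lemma complex_linear_right_inverse:
  fixes D :: "complex ^ 'n \<Rightarrow> complex ^ 'm"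
  assumes "complex_linear D"
  obtains g where "complex_linear g" "range g \<subseteq> model_space c"
    "\<And>v. v \<in> D ` model_space c \<Longrightarrow> D (g v) = v"
proof -
  have "Vector_Spaces.linear (*s) (*s) D"
    using assms unfolding complex_linear_def Vector_Spaces.linear_iff
    by (intro conjI vec.vector_space_axioms) simp_all
  moreover have "vec.subspace (model_space c)" by (cases c) simp
  ultimately obtain g where g: "range g \<subseteq> model_space c" "Vector_Spaces.linear (*s) (*s) g"
    "\<forall>v\<in>D ` model_space c. D (g v) = v"
    using vec.linear_exists_right_inverse_on[of D "model_space c"] by blast
  from g(2) have "complex_linear g"
    unfolding complex_linear_def Vector_Spaces.linear_iff by blast
  then show ?thesis using that[of g] g(1,3) by simp
qed

section \<open>Charts\<close>

lemma chart_on_inj: "chart_on T (U, \<phi>) \<Longrightarrow> inj_on \<phi> U"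
  by (auto dest!: homeomorphic_imp_injective_map openin_subset simp: Int_absorb1)

lemma chart_on_image_open:
  assumes "chart_on T (U, \<phi>)" "openin T A"
  shows "openin (top_of_set (model_space (U, \<phi>))) (\<phi> ` (U \<inter> A))"
proof -
  have "openin (subtopology T U) (U \<inter> A)"
    using assms(2) by (auto simp: openin_subtopology)
  then have "openin (top_of_set (\<phi> ` U)) (\<phi> ` (U \<inter> A))"
    using assms(1) homeomorphic_imp_open_map[of "subtopology T U" "top_of_set (\<phi> ` U)" \<phi>]
    by (auto simp: open_map_def)
  then show ?thesis using assms(1) by (auto intro: openin_trans)
qed

lemma chart_on_preimage_open:
  assumes "chart_on T (U, \<phi>)" "continuous_map T T' f" "openin T' V"
  shows "openin (top_of_set (model_space (U, \<phi>))) (\<phi> ` (U \<inter> f -` V))"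
proof -
  have "U \<inter> f -` V = U \<inter> {x \<in> topspace T. f x \<in> V}"
    using assms(1) openin_subset[of T U] by auto
  then show ?thesis
    using chart_on_image_open[OF assms(1) openin_continuous_map_preimage[OF assms(2,3)]] by simp
qed

text \<open>
  Derivatives of coordinate expressions are taken within their domains.  This lets a domain be
  shrunk to a neighbourhood on which an intermediate chart is available.
\<close>

lemma at_within_Int_open_subset:
  assumes "openin (top_of_set E) O'" "z \<in> O'" "S \<subseteq> E"
  shows "at z within (S \<inter> O') = at z within S"
proof -
  obtain W where "open W" "O' = E \<inter> W"
    using assms(1) by (auto simp: openin_open)
  then show ?thesis
    using assms(2,3) by (intro at_within_nhd[of z W]) auto
qed

lemma manifold_chart_at:
  assumes "complex_manifold M" "x \<in> topspace (mtop M)"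
  obtains U \<phi> where "(U, \<phi>) \<in> charts M" "x \<in> U" "chart_on (mtop M) (U, \<phi>)"
  using assms unfolding complex_manifold_def by (auto simp del: chart_on.simps)

section \<open>Composition\<close>

lemma antiholomorphic_map_postcompose:
  assumes L: "complex_manifold L" and M: "complex_manifold M"
    and f: "antiholomorphic_map L M f" and g: "holomorphic_map M N g"
  shows "antiholomorphic_map L N (g \<circ> f)"
  unfolding antiholomorphic_map_def
proof (intro conjI ballI, safe)
  have cf: "continuous_map (mtop L) (mtop M) f" and cg: "continuous_map (mtop M) (mtop N) g"
    using f g by (auto simp: antiholomorphic_map_def holomorphic_map_def)
  then show "continuous_map (mtop L) (mtop N) (g \<circ> f)" by (rule continuous_map_compose)
  fix U \<phi> V \<psi> assume U: "(U, \<phi>) \<in> charts L" and V: "(V, \<psi>) \<in> charts N"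
  have ch: "chart_on (mtop L) (U, \<phi>)" using L U by (auto simp: complex_manifold_def)
  note inj = chart_on_inj[OF ch]
  define S where "S = \<phi> ` (U \<inter> (g \<circ> f) -` V)"
  have SE: "S \<subseteq> model_space (U, \<phi>)" by (auto simp: S_def intro: vec.span_base)
  show "cvec_antiholomorphic_on (\<psi> \<circ> (g \<circ> f) \<circ> inv_into U \<phi>) (\<phi> ` (U \<inter> (g \<circ> f) -` V))"
    unfolding cvec_antiholomorphic_on_def S_def[symmetric]
  proof
    fix z assume zS: "z \<in> S"
    then obtain x where x: "x \<in> U" "g (f x) \<in> V" "z = \<phi> x" by (auto simp: S_def)
    have "x \<in> topspace (mtop L)" using ch x(1) by (auto dest: openin_subset)
    then have "f x \<in> topspace (mtop M)" using continuous_map_image_subset_topspace[OF cf] by blast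
    then obtain W \<theta> where W: "(W, \<theta>) \<in> charts M" "f x \<in> W" "chart_on (mtop M) (W, \<theta>)"
      using manifold_chart_at[OF M] by blast
    note injW = chart_on_inj[OF W(3)]
    define O' where "O' = \<phi> ` (U \<inter> f -` W)"
    have O': "openin (top_of_set (model_space (U, \<phi>))) O'"
      unfolding O'_def by (rule chart_on_preimage_open[OF ch cf]) (use W(3) in simp)
    have zO: "z \<in> O'" using x W(2) by (auto simp: O'_def)
    have "S \<inter> O' = \<phi> ` (U \<inter> (g \<circ> f) -` V \<inter> (U \<inter> f -` W))"
      unfolding S_def O'_def by (rule inj_on_image_Int[OF inj, symmetric]) auto
    then have SO: "s \<in> S \<inter> O' \<Longrightarrow> \<exists>y\<in>U. f y \<in> W \<and> g (f y) \<in> V \<and> s = \<phi> y" for s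
      by auto
    let ?a = "\<theta> \<circ> f \<circ> inv_into U \<phi>" and ?b = "\<psi> \<circ> g \<circ> inv_into W \<theta>"
    obtain D where D: "complex_antilinear D" "(?a has_derivative D) (at z within O')"
      using f U W(1) zO unfolding antiholomorphic_map_def cvec_antiholomorphic_on_def O'_def
      by blast
    have za: "?a z \<in> \<theta> ` (W \<inter> g -` V)" using x W(2) inj by auto
    then obtain D' where D': "complex_linear D'"
      "(?b has_derivative D') (at (?a z) within \<theta> ` (W \<inter> g -` V))"
      using g W(1) V unfolding holomorphic_map_def cvec_holomorphic_on_def by blast
    have "?a ` (S \<inter> O') \<subseteq> \<theta> ` (W \<inter> g -` V)" using SO inj by fastforce
    then have "((\<lambda>x. ?b (?a x)) has_derivative (\<lambda>v. D' (D v))) (at z within S \<inter> O')"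
      by (intro has_derivative_in_compose[OF has_derivative_subset[OF D(2)]]
          has_derivative_subset[OF D'(2)]) auto
    then have "(\<psi> \<circ> (g \<circ> f) \<circ> inv_into U \<phi> has_derivative (\<lambda>v. D' (D v))) (at z within S \<inter> O')"
    proof (rule has_derivative_transform[rotated 2])
      show "z \<in> S \<inter> O'" using zS zO by simp
      fix s assume "s \<in> S \<inter> O'"
      then show "(\<psi> \<circ> (g \<circ> f) \<circ> inv_into U \<phi>) s = ?b (?a s)"
        using SO[of s] inj injW by auto
    qed
    moreover have "complex_antilinear (\<lambda>v. D' (D v))"
      using D(1) D'(1) by (simp add: complex_antilinear_def complex_linear_def)
    ultimately show "\<exists>D. complex_antilinear D \<and>
        (\<psi> \<circ> (g \<circ> f) \<circ> inv_into U \<phi> has_derivative D) (at z within S)"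
      using at_within_Int_open_subset[OF O' zO SE] by auto
  qed
qed

section \<open>Slices of a product manifold\<close>

lemma complex_linear_compose:
  "complex_linear f \<Longrightarrow> complex_linear g \<Longrightarrow> complex_linear (\<lambda>u. f (g u))"
  by (simp add: complex_linear_def)

definition pair_vec :: "'c ^ 'n \<Rightarrow> 'c ^ 'm \<Rightarrow> 'c ^ ('n::finite + 'm::finite)" where
  "pair_vec u v = (\<chi> i. case i of Inl j \<Rightarrow> u $ j | Inr j \<Rightarrow> v $ j)"

lemma pair_vec_eq_iff [simp]: "pair_vec u v = pair_vec u' v' \<longleftrightarrow> u = u' \<and> v = v'"
  by (fastforce simp: pair_vec_def vec_eq_iff split: sum.splits)

lemma pair_vec_affine: "pair_vec u v = pair_vec u 0 + pair_vec 0 (v :: complex ^ 'm)"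
  by (simp add: pair_vec_def vec_eq_iff split: sum.splits)

lemma complex_linear_pair_vec: "complex_linear (\<lambda>u. pair_vec u 0)"
  by (simp add: complex_linear_def pair_vec_def vec_eq_iff split: sum.splits)

lemma prod_chart_pair_vec:
  "prod_chart (U, \<phi>) (V, \<psi>) = (U \<times> V, \<lambda>(x, y). pair_vec (\<phi> x) (\<psi> y))"
  by (simp add: pair_vec_def)

text \<open>
  In coordinates the inclusion \<open>x \<mapsto> (x, b)\<close> is the affine map \<open>u \<mapsto> pair_vec u (\<theta> b)\<close>, whose linear part
  is complex linear.
\<close>

lemma holomorphic_map_slice:
  assumes M: "complex_manifold M" and N: "complex_manifold N"
    and f: "holomorphic_map (prod_manifold M N) L f" and b: "b \<in> topspace (mtop N)"
  shows "holomorphic_map M L (\<lambda>x. f (x, b))"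
  unfolding holomorphic_map_def
proof (intro conjI ballI, safe)
  have "continuous_map (mtop M) (prod_topology (mtop M) (mtop N)) (\<lambda>x. (x, b))"
    using b by (simp add: continuous_map_pairwise comp_def)
  moreover have "continuous_map (prod_topology (mtop M) (mtop N)) (mtop L) f"
    using f by (simp add: holomorphic_map_def prod_manifold_def)
  ultimately show "continuous_map (mtop M) (mtop L) (\<lambda>x. f (x, b))"
    using continuous_map_compose[of _ _ "\<lambda>x. (x, b)" _ f] by (simp add: comp_def)
  fix U \<phi> V \<psi> assume U: "(U, \<phi>) \<in> charts M" and V: "(V, \<psi>) \<in> charts L"
  obtain W \<theta> where W: "(W, \<theta>) \<in> charts N" "b \<in> W" "chart_on (mtop N) (W, \<theta>)"
    using manifold_chart_at[OF N b] by blast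
  have ch: "chart_on (mtop M) (U, \<phi>)" using M U by (auto simp: complex_manifold_def)
  note inj = chart_on_inj[OF ch] and injW = chart_on_inj[OF W(3)]
  define \<Phi> where "\<Phi> = (\<lambda>(x, y). pair_vec (\<phi> x) (\<theta> y))"
  have "(U \<times> W, \<Phi>) \<in> charts (prod_manifold M N)"
    using U W(1) unfolding \<Phi>_def prod_chart_pair_vec[symmetric]
    by (auto simp: prod_manifold_def simp del: prod_chart.simps)
  then have hol: "cvec_holomorphic_on (\<psi> \<circ> f \<circ> inv_into (U \<times> W) \<Phi>) (\<Phi> ` (U \<times> W \<inter> f -` V))"
    using f V unfolding holomorphic_map_def by blast
  have inj\<Phi>: "inj_on \<Phi> (U \<times> W)"
    using inj injW by (auto simp: \<Phi>_def inj_on_def)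
  define S where "S = \<phi> ` (U \<inter> (\<lambda>x. f (x, b)) -` V)"
  let ?j = "\<lambda>z. pair_vec z (\<theta> b)"
  have j: "?j s \<in> \<Phi> ` (U \<times> W \<inter> f -` V) \<and> inv_into (U \<times> W) \<Phi> (?j s) = (inv_into U \<phi> s, b)"
    if "s \<in> S" for s
  proof -
    obtain x where x: "x \<in> U" "f (x, b) \<in> V" "s = \<phi> x" using \<open>s \<in> S\<close> by (auto simp: S_def)
    then have "?j s = \<Phi> (x, b)" by (simp add: \<Phi>_def)
    then show ?thesis using x W(2) inj inv_into_f_f[OF inj\<Phi>, of "(x, b)"] by auto
  qed
  show "cvec_holomorphic_on (\<psi> \<circ> (\<lambda>x. f (x, b)) \<circ> inv_into U \<phi>) (\<phi> ` (U \<inter> (\<lambda>x. f (x, b)) -` V))"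
    unfolding cvec_holomorphic_on_def S_def[symmetric]
  proof
    fix z assume zS: "z \<in> S"
    have "((\<lambda>u. pair_vec u 0 + pair_vec 0 (\<theta> b)) has_derivative (\<lambda>u. pair_vec u 0)) (at z within S)"
      by (intro has_derivative_add_const bounded_linear_imp_has_derivative
          complex_linear_imp_bounded_linear complex_linear_pair_vec)
    then have dj: "(?j has_derivative (\<lambda>u. pair_vec u 0)) (at z within S)"
      by (simp only: pair_vec_affine[symmetric])
    obtain D where D: "complex_linear D"
      "(\<psi> \<circ> f \<circ> inv_into (U \<times> W) \<Phi> has_derivative D) (at (?j z) within \<Phi> ` (U \<times> W \<inter> f -` V))"
      using hol j[OF zS] unfolding cvec_holomorphic_on_def by blast
    have "?j ` S \<subseteq> \<Phi> ` (U \<times> W \<inter> f -` V)" using j by blast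
    from has_derivative_in_compose[OF dj has_derivative_subset[OF D(2) this]]
    have "(\<psi> \<circ> (\<lambda>x. f (x, b)) \<circ> inv_into U \<phi> has_derivative (\<lambda>u. D (pair_vec u 0))) (at z within S)"
      by (rule has_derivative_transform[rotated 2]) (use zS j in auto)
    moreover have "complex_linear (\<lambda>u. D (pair_vec u 0))"
      by (rule complex_linear_compose[OF D(1) complex_linear_pair_vec])
    ultimately show "\<exists>D. complex_linear D \<and>
        (\<psi> \<circ> (\<lambda>x. f (x, b)) \<circ> inv_into U \<phi> has_derivative D) (at z within S)"
      by blast
  qed
qed

section \<open>Descent of antiholomorphy along a submersion\<close>

text \<open>
  At a point \<open>x = p m\<close>, the coordinate expression \<open>F\<close> of \<open>f\<close> satisfies \<open>F \<circ> P = Q\<close>, where \<open>P\<close> and \<open>Q\<close> are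
  those of \<open>p\<close> and \<open>q\<close> near \<open>m\<close>.  Hence \<open>F\<close> has derivative \<open>Q' \<circ> g\<close> with \<open>g\<close> a right inverse of \<open>P'\<close>;
  choosing \<open>g\<close> complex linear makes it antilinear.
\<close>

lemma antiholomorphic_map_descends:
  assumes M: "complex_manifold M" and N: "complex_manifold N" and L: "complex_manifold L"
    and p: "holomorphic_submersion M N p" "p ` topspace (mtop M) = topspace (mtop N)"
    and q: "antiholomorphic_map M L q"
    and f: "continuous_map (mtop N) (mtop L) f" "\<And>x. x \<in> topspace (mtop M) \<Longrightarrow> f (p x) = q x"
  shows "antiholomorphic_map N L f"
  unfolding antiholomorphic_map_def
proof (intro conjI ballI f(1), safe)
  have cp: "continuous_map (mtop M) (mtop N) p" and cq: "continuous_map (mtop M) (mtop L) q"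
    using p(1) q by (auto simp: holomorphic_submersion_def holomorphic_map_def antiholomorphic_map_def)
  fix U \<phi> V \<psi> assume U: "(U, \<phi>) \<in> charts N" and V: "(V, \<psi>) \<in> charts L"
  have chU: "chart_on (mtop N) (U, \<phi>)" and chV: "chart_on (mtop L) (V, \<psi>)"
    using N U L V by (auto simp: complex_manifold_def)
  note injU = chart_on_inj[OF chU]
  let ?F = "\<psi> \<circ> f \<circ> inv_into U \<phi>"
  show "cvec_antiholomorphic_on ?F (\<phi> ` (U \<inter> f -` V))"
    unfolding cvec_antiholomorphic_on_def
  proof
    fix y assume "y \<in> \<phi> ` (U \<inter> f -` V)"
    then obtain x where x: "x \<in> U" "f x \<in> V" "y = \<phi> x" by auto
    have "x \<in> topspace (mtop N)" using chU x(1) by (auto dest: openin_subset)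
    then obtain m where m: "m \<in> topspace (mtop M)" "x = p m" using p(2) by auto
    obtain W \<theta> where W: "(W, \<theta>) \<in> charts M" "m \<in> W" "chart_on (mtop M) (W, \<theta>)"
      using manifold_chart_at[OF M m(1)] by blast
    note injW = chart_on_inj[OF W(3)]
    have WM: "W \<subseteq> topspace (mtop M)" using W(3) by (auto dest: openin_subset)
    let ?E = "model_space (W, \<theta>)" and ?E' = "model_space (U, \<phi>)"
    let ?P = "\<phi> \<circ> p \<circ> inv_into W \<theta>" and ?Q = "\<psi> \<circ> q \<circ> inv_into W \<theta>"
    let ?SP = "\<theta> ` (W \<inter> p -` U)" and ?SQ = "\<theta> ` (W \<inter> q -` V)"
    define S where "S = ?SP \<inter> ?SQ"
    have S: "openin (top_of_set ?E) S"
      unfolding S_def using chart_on_preimage_open[OF W(3) cp] chart_on_preimage_open[OF W(3) cq]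
        chU chV by (intro openin_Int) auto
    have "S = \<theta> ` (W \<inter> p -` U \<inter> (W \<inter> q -` V))"
      unfolding S_def by (rule inj_on_image_Int[OF injW, symmetric]) auto
    then have SD: "\<exists>w\<in>W. p w \<in> U \<and> q w \<in> V \<and> s = \<theta> w" if "s \<in> S" for s
      using that by auto
    let ?z = "\<theta> m"
    have z: "?z \<in> S" using W(2) m x f(2)[OF m(1)] by (auto simp: S_def)
    have Pz: "?P ?z = y" using W(2) m x injW by simp
    obtain P' where P': "complex_linear P'" "(?P has_derivative P') (at ?z within ?SP)" "P' ` ?E = ?E'"
      using p(1) W(1) U z unfolding holomorphic_submersion_def S_def by blast
    obtain Q' where Q': "complex_antilinear Q'" "(?Q has_derivative Q') (at ?z within ?SQ)"
      using q W(1) V z unfolding antiholomorphic_map_def cvec_antiholomorphic_on_def S_def by blast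
    obtain g where g: "complex_linear g" "range g \<subseteq> ?E" "\<And>v. v \<in> P' ` ?E \<Longrightarrow> P' (g v) = v"
      using complex_linear_right_inverse[OF P'(1)] by blast
    have "continuous_on ?SP ?P"
      unfolding continuous_on_eq_continuous_within
      using p(1) W(1) U has_derivative_continuous
      unfolding holomorphic_submersion_def by blast
    then have contP: "continuous_on S ?P" by (rule continuous_on_subset) (simp add: S_def)
    have rangeP: "?P ` S \<subseteq> ?E'"
      using SD injW by (force intro: vec.span_base)
    have FP: "?F (?P w) = ?Q w" if "w \<in> S" for w
      using SD[OF that] injW injU WM f(2) by auto
    have "(?F has_derivative (\<lambda>v. Q' (g v))) (at (?P ?z) within ?E')"
    proof (rule has_derivative_descends[OF subspace_model_space subspace_model_space S z contP rangeP])
      show "(?P has_derivative P') (at ?z within S)" "(?Q has_derivative Q') (at ?z within S)"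
        using P'(2) Q'(2) by (auto simp: S_def intro: has_derivative_subset)
    qed (use g P'(3) FP complex_linear_imp_bounded_linear in auto)
    then have "(?F has_derivative (\<lambda>v. Q' (g v))) (at y within \<phi> ` (U \<inter> f -` V))"
      unfolding Pz by (rule has_derivative_subset) (auto intro: vec.span_base)
    moreover have "complex_antilinear (\<lambda>v. Q' (g v))"
      using Q'(1) g(1) by (simp add: complex_antilinear_def complex_linear_def)
    ultimately show "\<exists>D. complex_antilinear D \<and>
        (?F has_derivative D) (at y within \<phi> ` (U \<inter> f -` V))" by blast
  qed
qed

section \<open>Conjugate subgroups and left cosets\<close>

context group
begin

lemma cancel_inv_left:
  assumes "a \<in> carrier G" "x \<in> carrier G"
  shows "inv a \<otimes> (a \<otimes> x) = x" "a \<otimes> (inv a \<otimes> x) = x"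
  using assms by (simp_all flip: m_assoc)

lemma inner_automorphism_image:
  assumes "a \<in> carrier G" "H \<subseteq> carrier G"
  shows "inner_automorphism G a ` H = a <# H #> inv a"
  by (auto simp: inner_automorphism_def l_coset_def r_coset_def)

lemma mem_conjugate_iff:
  assumes "a \<in> carrier G" "g \<in> carrier G" "H \<subseteq> carrier G"
  shows "g \<in> inner_automorphism G a ` H \<longleftrightarrow> inv a \<otimes> g \<otimes> a \<in> H"
proof
  assume "g \<in> inner_automorphism G a ` H"
  then obtain h where h: "h \<in> H" "g = a \<otimes> h \<otimes> inv a" by (auto simp: inner_automorphism_def)
  then have "inv a \<otimes> g \<otimes> a = h"
    using assms by (auto simp: m_assoc cancel_inv_left subset_iff)
  with h show "inv a \<otimes> g \<otimes> a \<in> H" by simp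
next
  assume "inv a \<otimes> g \<otimes> a \<in> H"
  moreover have "g = inner_automorphism G a (inv a \<otimes> g \<otimes> a)"
    using assms by (simp add: inner_automorphism_def m_assoc cancel_inv_left)
  ultimately show "g \<in> inner_automorphism G a ` H" by blast
qed

lemma lcos_eq_iff:
  assumes "subgroup H G" "a \<in> carrier G" "b \<in> carrier G"
  shows "a <# H = b <# H \<longleftrightarrow> inv a \<otimes> b \<in> H"
proof
  assume "a <# H = b <# H"
  then have "b \<in> a <# H" using lcos_self[OF assms(3,1)] by simp
  then show "inv a \<otimes> b \<in> H"
    using subgroup.lcos_module_imp[OF assms(1) is_group assms(2)] by blast
next
  assume "inv a \<otimes> b \<in> H"
  then have "b \<in> a <# H" using subgroup.lcos_module_rev[OF assms(1) is_group assms(2,3)] by blast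
  then show "a <# H = b <# H" using l_repr_independence assms by blast
qed

text \<open>
  The stabiliser of the point \<open>aH\<close> of \<open>G/H\<close> is \<open>a H a\<^sup>-\<^sup>1\<close>.
\<close>

lemma lcos_fixed_iff:
  assumes "subgroup H G" "a \<in> carrier G" "g \<in> carrier G"
  shows "g <# (a <# H) = a <# H \<longleftrightarrow> g \<in> inner_automorphism G a ` H"
proof -
  have "g <# (a <# H) = a <# H \<longleftrightarrow> a <# H = (g \<otimes> a) <# H"
    using assms lcos_m_assoc subgroup.subset by metis
  also have "\<dots> \<longleftrightarrow> inv a \<otimes> (g \<otimes> a) \<in> H" using lcos_eq_iff assms by simp
  also have "\<dots> \<longleftrightarrow> g \<in> inner_automorphism G a ` H"
    using mem_conjugate_iff assms subgroup.subset[OF assms(1)] by (simp add: m_assoc)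
  finally show ?thesis .
qed

lemma mem_normalizer_iff:
  assumes "H \<subseteq> carrier G"
  shows "n \<in> normalizer G H \<longleftrightarrow> n \<in> carrier G \<and> inner_automorphism G n ` H = H"
  using assms inner_automorphism_image[OF _ assms]
  by (simp add: normalizer_def stabilizer_def cong: conj_cong)

lemma conjugate_eq_imp_mem_normalizer:
  assumes H: "H \<subseteq> carrier G" and a: "a \<in> carrier G" and b: "b \<in> carrier G"
    and eq: "inner_automorphism G a ` H = inner_automorphism G b ` H"
  shows "inv a \<otimes> b \<in> normalizer G H"
proof -
  have "inner_automorphism G (inv a \<otimes> b) ` H = (\<lambda>g. inv a \<otimes> g \<otimes> a) ` (inner_automorphism G b ` H)"
    unfolding image_image
  proof (rule image_cong[OF refl])
    fix h assume "h \<in> H"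
    then show "inner_automorphism G (inv a \<otimes> b) h = inv a \<otimes> inner_automorphism G b h \<otimes> a"
      using H a b by (auto simp: inner_automorphism_def inv_mult_group m_assoc cancel_inv_left subset_iff)
  qed
  also have "\<dots> = (\<lambda>h. inv a \<otimes> inner_automorphism G a h \<otimes> a) ` H"
    unfolding eq[symmetric] image_image ..
  also have "\<dots> = (\<lambda>h. h) ` H"
  proof (rule image_cong[OF refl])
    fix h assume "h \<in> H"
    then show "inv a \<otimes> inner_automorphism G a h \<otimes> a = h"
      using H a by (auto simp: inner_automorphism_def m_assoc cancel_inv_left subset_iff)
  qed
  finally show ?thesis using mem_normalizer_iff[OF H] a b by simp
qed

text \<open>
  Equivariance sends the stabiliser \<open>H\<close> of the base point into the stabiliser \<open>b H b\<^sup>-\<^sup>1\<close> of \<open>bH\<close>.  For the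
  other inclusion the same argument is run from \<open>bH\<close>, which \<open>\<rho>\<close> sends back to the base point.
\<close>

lemma equivariant_involution_imp_conjugate:
  assumes H: "subgroup H G" and \<sigma>: "\<sigma> \<in> hom G G" "\<And>g. g \<in> carrier G \<Longrightarrow> \<sigma> (\<sigma> g) = g"
    and \<rho>_inv: "\<And>x. x \<in> lcosets H \<Longrightarrow> \<rho> (\<rho> x) = x"
    and \<rho>_eqv: "\<And>g x. g \<in> carrier G \<Longrightarrow> x \<in> lcosets H \<Longrightarrow> \<rho> (g <# x) = \<sigma> g <# \<rho> x"
    and b: "b \<in> carrier G" "\<rho> H = b <# H"
  shows "\<sigma> ` H = inner_automorphism G b ` H"
proof
  note HG = subgroup.subset[OF H]
  have \<sigma>c: "g \<in> carrier G \<Longrightarrow> \<sigma> g \<in> carrier G" for g using hom_in_carrier[OF \<sigma>(1)] .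
  have cosets: "H \<in> lcosets H" "b <# H \<in> lcosets H"
    using lcos_mult_one[OF HG] b(1) unfolding LCOSETS_def by force+
  show "\<sigma> ` H \<subseteq> inner_automorphism G b ` H"
  proof (rule image_subsetI)
    fix h assume h: "h \<in> H"
    then have "h <# H = H" using lcos_eq_iff[OF H one_closed, of h] lcos_mult_one[OF HG] HG
      by (simp add: subset_iff)
    then have "\<sigma> h <# (b <# H) = b <# H" using \<rho>_eqv[of h H] h HG cosets b(2) by auto
    then show "\<sigma> h \<in> inner_automorphism G b ` H"
      using lcos_fixed_iff[OF H b(1)] \<sigma>c h HG by blast
  qed
  show "inner_automorphism G b ` H \<subseteq> \<sigma> ` H"
  proof
    fix g assume g: "g \<in> inner_automorphism G b ` H"
    then have gG: "g \<in> carrier G" using b(1) HG by (auto simp: inner_automorphism_def)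
    have "g <# (b <# H) = b <# H" using g gG lcos_fixed_iff[OF H b(1)] by blast
    moreover have "\<rho> (b <# H) = H" using \<rho>_inv[OF cosets(1)] b(2) by simp
    ultimately have "\<sigma> g <# H = H" using \<rho>_eqv[OF gG cosets(2)] by simp
    then have "\<sigma> g \<in> H" using lcos_self[OF \<sigma>c[OF gG] H] by simp
    then show "g \<in> \<sigma> ` H" using \<sigma>(2)[OF gG] by force
  qed
qed

lemma hom_image_inner_automorphism:
  assumes \<sigma>: "\<sigma> \<in> hom G G" and a: "a \<in> carrier G" and H: "H \<subseteq> carrier G"
  shows "\<sigma> ` (inner_automorphism G a ` H) = inner_automorphism G (\<sigma> a) ` (\<sigma> ` H)"
proof -
  interpret \<sigma>: group_hom G G \<sigma> using \<sigma> by unfold_locales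
  show ?thesis unfolding image_image
    using a H by (intro image_cong) (auto simp: inner_automorphism_def)
qed

text \<open>
  Applying \<open>\<sigma>\<close> to \<open>\<sigma> H = a H a\<^sup>-\<^sup>1\<close> gives \<open>H = \<sigma>(a) (\<sigma> H) \<sigma>(a)\<^sup>-\<^sup>1\<close>, and substituting for \<open>\<sigma> H\<close> again gives
  conjugation by \<open>\<sigma>(a) a\<close>.
\<close>

lemma involution_cocycle_mem_normalizer:
  assumes H: "H \<subseteq> carrier G" and \<sigma>: "\<sigma> \<in> hom G G" "\<And>g. g \<in> carrier G \<Longrightarrow> \<sigma> (\<sigma> g) = g"
    and a: "a \<in> carrier G" and conj: "\<sigma> ` H = inner_automorphism G a ` H"
  shows "\<sigma> a \<otimes> a \<in> normalizer G H"
proof -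
  have \<sigma>a: "\<sigma> a \<in> carrier G" using hom_in_carrier[OF \<sigma>(1) a] .
  have "\<sigma> ` (\<sigma> ` H) = (\<lambda>h. h) ` H"
    unfolding image_image using \<sigma>(2) H by (intro image_cong) auto
  then have "H = \<sigma> ` (\<sigma> ` H)" by simp
  also have "\<dots> = inner_automorphism G (\<sigma> a) ` (inner_automorphism G a ` H)"
    using hom_image_inner_automorphism[OF \<sigma>(1) a H] conj by simp
  also have "\<dots> = inner_automorphism G (\<sigma> a \<otimes> a) ` H"
    unfolding image_image using H a \<sigma>a
    by (intro image_cong) (auto simp: inner_automorphism_def inv_mult_group m_assoc subset_iff)
  finally show ?thesis using mem_normalizer_iff[OF H] a \<sigma>a by auto
qed

text \<open>
  The map \<open>gH \<mapsto> \<sigma> g a H\<close> is given by the set-level formula \<open>x \<mapsto> \<sigma>(x) a\<close>, which involves no choice of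
  representative; this settles well-definedness.
\<close>

lemma hom_image_lcos_twisted:
  assumes H: "subgroup H G" and \<sigma>: "\<sigma> \<in> hom G G"
    and a: "a \<in> carrier G" and conj: "\<sigma> ` H = inner_automorphism G a ` H"
    and g: "g \<in> carrier G"
  shows "\<sigma> ` (g <# H) #> a = (\<sigma> g \<otimes> a) <# H"
proof -
  note HG = subgroup.subset[OF H]
  have \<sigma>g: "\<sigma> g \<in> carrier G" using hom_in_carrier[OF \<sigma> g] .
  have "\<sigma> ` (g <# H) #> a = (\<lambda>h. \<sigma> (g \<otimes> h) \<otimes> a) ` H"
    by (auto simp: l_coset_def r_coset_def)
  also have "\<dots> = (\<lambda>k. \<sigma> g \<otimes> k \<otimes> a) ` (\<sigma> ` H)"
    unfolding image_image using hom_mult[OF \<sigma> g] HG by (intro image_cong) auto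
  also have "\<dots> = (\<lambda>h. \<sigma> g \<otimes> a \<otimes> h) ` H"
    unfolding conj image_image
    using HG a \<sigma>g by (intro image_cong) (auto simp: inner_automorphism_def m_assoc cancel_inv_left subset_iff)
  also have "\<dots> = (\<sigma> g \<otimes> a) <# H" by (auto simp: l_coset_def)
  finally show ?thesis .
qed

end

section \<open>Antiholomorphic maps of a homogeneous space\<close>

lemma homogeneous_space_charts_cases:
  assumes "c \<in> charts (homogeneous_space G M H)"
  obtains A where "c \<in> A" "complex_manifold \<lparr> mtop = mtop (homogeneous_space G M H), charts = A \<rparr>"
    "holomorphic_submersion M \<lparr> mtop = mtop (homogeneous_space G M H), charts = A \<rparr> (\<lambda>g. g <#\<^bsub>G\<^esub> H)"
  using assms by (auto simp: homogeneous_space_def Let_def)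

text \<open>
  The charts of \<open>G/H\<close> are collected from all admissible atlases, so the charts at the source and at the
  target may come from different atlases \<open>A\<close> and \<open>B\<close>.  The projection is a submersion for \<open>A\<close> and
  holomorphic for \<open>B\<close>, so the descent lemma is applied with \<open>A\<close> at the source and \<open>B\<close> at the target.
\<close>

lemma homogeneous_space_antiholomorphic_map:
  fixes G :: "('a, 'b) monoid_scheme" and M :: "('a, 'n::finite) complex_space" and H :: "'a set"
  defines "X \<equiv> homogeneous_space G M H" and "p \<equiv> (\<lambda>g. g <#\<^bsub>G\<^esub> H)"
  assumes M: "complex_manifold M" and \<tau>: "antiholomorphic_map M M \<tau>"
    and f: "\<And>x. x \<in> topspace (mtop M) \<Longrightarrow> f (p x) = p (\<tau> x)"
  shows "antiholomorphic_map X X f"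
proof -
  have X: "mtop X = quotient_topology (mtop M) p"
    by (simp add: X_def p_def homogeneous_space_def Let_def)
  have quot: "quotient_map (mtop M) (mtop X) p"
    unfolding X by (rule quotient_map_quotient_topology)
  have "continuous_map (mtop M) (mtop X) (p \<circ> \<tau>)"
    using \<tau> quotient_imp_continuous_map[OF quot]
    by (auto simp: antiholomorphic_map_def intro: continuous_map_compose)
  then have "continuous_map (mtop M) (mtop X) (f \<circ> p)"
    by (rule continuous_map_eq) (simp add: f)
  then have cf: "continuous_map (mtop X) (mtop X) f"
    by (rule continuous_compose_quotient_map[OF quot])
  have "cvec_antiholomorphic_on (\<psi> \<circ> f \<circ> inv_into U \<phi>) (\<phi> ` (U \<inter> f -` V))"
    if U: "(U, \<phi>) \<in> charts X" and V: "(V, \<psi>) \<in> charts X" for U \<phi> V \<psi>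
  proof -
    obtain A where A: "(U, \<phi>) \<in> A" "complex_manifold \<lparr> mtop = mtop X, charts = A \<rparr>"
      "holomorphic_submersion M \<lparr> mtop = mtop X, charts = A \<rparr> p"
      using homogeneous_space_charts_cases[OF U[unfolded X_def]] unfolding X_def p_def by blast
    obtain B where B: "(V, \<psi>) \<in> B" "complex_manifold \<lparr> mtop = mtop X, charts = B \<rparr>"
      "holomorphic_submersion M \<lparr> mtop = mtop X, charts = B \<rparr> p"
      using homogeneous_space_charts_cases[OF V[unfolded X_def]] unfolding X_def p_def by blast
    have "antiholomorphic_map M \<lparr> mtop = mtop X, charts = B \<rparr> (p \<circ> \<tau>)"
      by (rule antiholomorphic_map_postcompose[OF M M \<tau>])
        (use B(3) in \<open>simp add: holomorphic_submersion_def\<close>)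
    then have "antiholomorphic_map \<lparr> mtop = mtop X, charts = A \<rparr> \<lparr> mtop = mtop X, charts = B \<rparr> f"
      using M A B cf f by (intro antiholomorphic_map_descends[of M _ _ p "p \<circ> \<tau>"]) (auto simp: X)
    then show ?thesis
      using A(1) B(1) unfolding antiholomorphic_map_def by auto
  qed
  then show ?thesis using cf by (auto simp: antiholomorphic_map_def)
qed

lemma antiholomorphic_twisted_translation:
  assumes "complex_lie_group G M" "antiholomorphic_map M M \<sigma>" "a \<in> carrier G"
  shows "antiholomorphic_map M M (\<lambda>g. \<sigma> g \<otimes>\<^bsub>G\<^esub> a)"
proof -
  have M: "complex_manifold M" using assms by (simp add: complex_lie_group_def)
  have "holomorphic_map M M (\<lambda>g. g \<otimes>\<^bsub>G\<^esub> a)"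
    using holomorphic_map_slice[OF M M, of M "\<lambda>(x, y). x \<otimes>\<^bsub>G\<^esub> y" a] assms
    by (simp add: complex_lie_group_def)
  from antiholomorphic_map_postcompose[OF M M assms(2) this] show ?thesis
    by (simp add: comp_def)
qed

section \<open>Equivariant real structures\<close>

theorem theorem2p1:
  fixes G :: "('a, 'b) monoid_scheme"
    and M :: "('a, 'n::finite) complex_space"
    and \<sigma> :: "'a \<Rightarrow> 'a"
    and H :: "'a set"
  assumes "complex_lie_group G M"
    and "antiholomorphic_involution G M \<sigma>"
    and "closed_complex_lie_subgroup G M H"
  defines "X \<equiv> homogeneous_space G M H"
  shows "((\<exists>\<rho>. real_structure X \<rho> \<and> equivariant G \<sigma> X (left_translation G) \<rho>)
            \<longrightarrow> conjugate_by_inner G (\<sigma> ` H) H) \<and>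
         (conjugate_by_inner G (\<sigma> ` H) H \<and> normalizer G H = H
            \<longrightarrow> (\<exists>!\<rho>. \<rho> \<in> extensional (topspace (mtop X)) \<and>
                      real_structure X \<rho> \<and> equivariant G \<sigma> X (left_translation G) \<rho>))"
proof -
  interpret group G using assms(1) by (simp add: complex_lie_group_def)
  have M: "complex_manifold M" "topspace (mtop M) = carrier G"
    using assms(1) by (auto simp: complex_lie_group_def)
  have H: "subgroup H G" using assms(3) by (simp add: closed_complex_lie_subgroup_def)
  note HG = subgroup.subset[OF H]
  have \<sigma>: "\<sigma> \<in> hom G G" "\<And>g. g \<in> carrier G \<Longrightarrow> \<sigma> (\<sigma> g) = g" "antiholomorphic_map M M \<sigma>"
    using assms(2) by (auto simp: antiholomorphic_involution_def iso_def)
  note \<sigma>G = hom_in_carrier[OF \<sigma>(1)]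
  have X: "topspace (mtop X) = lcosets\<^bsub>G\<^esub> H"
    unfolding X_def by (rule topspace_homogeneous_space[OF assms(1)])
  have coset: "\<And>g. g \<in> carrier G \<Longrightarrow> g <#\<^bsub>G\<^esub> H \<in> lcosets\<^bsub>G\<^esub> H"
    and coset_cases: "\<And>x. x \<in> lcosets\<^bsub>G\<^esub> H \<Longrightarrow> \<exists>g\<in>carrier G. x = g <#\<^bsub>G\<^esub> H"
    by (auto simp: LCOSETS_def)
  have base: "\<one>\<^bsub>G\<^esub> <#\<^bsub>G\<^esub> H = H" by (rule lcos_mult_one[OF HG])
  let ?R = "\<lambda>\<rho>. real_structure X \<rho> \<and> equivariant G \<sigma> X (left_translation G) \<rho>"

  \<comment> \<open>Any equivariant real structure is \<open>gH \<mapsto> \<sigma> g b H\<close>, with \<open>b\<close> conjugating \<open>H\<close> to \<open>\<sigma> H\<close>.\<close>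
  have shape: "\<exists>b\<in>carrier G. \<sigma> ` H = inner_automorphism G b ` H
                 \<and> (\<forall>g\<in>carrier G. \<rho> (g <#\<^bsub>G\<^esub> H) = (\<sigma> g \<otimes>\<^bsub>G\<^esub> b) <#\<^bsub>G\<^esub> H)" if "?R \<rho>" for \<rho>
  proof -
    have inv: "\<And>x. x \<in> lcosets\<^bsub>G\<^esub> H \<Longrightarrow> \<rho> (\<rho> x) = x"
      and eqv: "\<And>g x. g \<in> carrier G \<Longrightarrow> x \<in> lcosets\<^bsub>G\<^esub> H \<Longrightarrow> \<rho> (g <#\<^bsub>G\<^esub> x) = \<sigma> g <#\<^bsub>G\<^esub> \<rho> x"
      and cont: "continuous_map (mtop X) (mtop X) \<rho>"
      using that by (auto simp: real_structure_def equivariant_def antiholomorphic_map_def X)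
    have H_coset: "H \<in> lcosets\<^bsub>G\<^esub> H" using coset[OF one_closed] base by simp
    then have "\<rho> H \<in> lcosets\<^bsub>G\<^esub> H" using continuous_map_image_subset_topspace[OF cont] X by auto
    then obtain b where b: "b \<in> carrier G" "\<rho> H = b <#\<^bsub>G\<^esub> H" using coset_cases by blast
    have "\<sigma> ` H = inner_automorphism G b ` H"
      by (rule equivariant_involution_imp_conjugate[OF H \<sigma>(1,2) inv eqv b])
    moreover have "\<rho> (g <#\<^bsub>G\<^esub> H) = (\<sigma> g \<otimes>\<^bsub>G\<^esub> b) <#\<^bsub>G\<^esub> H" if "g \<in> carrier G" for g
      using eqv[OF that H_coset] b lcos_m_assoc[OF HG \<sigma>G[OF that] b(1)] by simp
    ultimately show ?thesis using b(1) by blast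
  qed

  have "\<exists>!\<rho>. \<rho> \<in> extensional (topspace (mtop X)) \<and> ?R \<rho>"
    if "conjugate_by_inner G (\<sigma> ` H) H" and self_norm: "normalizer G H = H"
  proof -
    obtain a where a: "a \<in> carrier G" and conj: "\<sigma> ` H = inner_automorphism G a ` H"
      using \<open>conjugate_by_inner G (\<sigma> ` H) H\<close> by (auto simp: conjugate_by_inner_def)
    define \<rho>0 where "\<rho>0 = (\<lambda>x\<in>topspace (mtop X). \<sigma> ` x #>\<^bsub>G\<^esub> a)"
    have \<rho>0: "\<rho>0 (g <#\<^bsub>G\<^esub> H) = (\<sigma> g \<otimes>\<^bsub>G\<^esub> a) <#\<^bsub>G\<^esub> H" if "g \<in> carrier G" for g
      using hom_image_lcos_twisted[OF H \<sigma>(1) a conj that] coset[OF that] by (simp add: \<rho>0_def X)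
    have "antiholomorphic_map X X \<rho>0"
      unfolding X_def
      by (rule homogeneous_space_antiholomorphic_map[OF M(1)
            antiholomorphic_twisted_translation[OF assms(1) \<sigma>(3) a]]) (simp add: \<rho>0 M(2))
    moreover have "\<rho>0 (\<rho>0 x) = x" if "x \<in> lcosets\<^bsub>G\<^esub> H" for x
    proof -
      obtain g where g: "g \<in> carrier G" "x = g <#\<^bsub>G\<^esub> H" using coset_cases[OF \<open>x \<in> lcosets\<^bsub>G\<^esub> H\<close>] by blast
      have "\<sigma> (\<sigma> g \<otimes>\<^bsub>G\<^esub> a) \<otimes>\<^bsub>G\<^esub> a = g \<otimes>\<^bsub>G\<^esub> (\<sigma> a \<otimes>\<^bsub>G\<^esub> a)"
        using g(1) a \<sigma>G \<sigma>(2) hom_mult[OF \<sigma>(1)] by (simp add: m_assoc)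
      moreover have "\<sigma> a \<otimes>\<^bsub>G\<^esub> a \<in> H"
        using involution_cocycle_mem_normalizer[OF HG \<sigma>(1,2) a conj] self_norm by simp
      ultimately have "(\<sigma> (\<sigma> g \<otimes>\<^bsub>G\<^esub> a) \<otimes>\<^bsub>G\<^esub> a) <#\<^bsub>G\<^esub> H = g <#\<^bsub>G\<^esub> H"
        using g(1) a \<sigma>G lcos_eq_iff[OF H g(1), of "g \<otimes>\<^bsub>G\<^esub> (\<sigma> a \<otimes>\<^bsub>G\<^esub> a)"]
        by (simp add: cancel_inv_left)
      then show ?thesis using g a \<sigma>G \<rho>0 by simp
    qed
    moreover have "\<rho>0 (g <#\<^bsub>G\<^esub> x) = \<sigma> g <#\<^bsub>G\<^esub> \<rho>0 x" if g: "g \<in> carrier G" and "x \<in> lcosets\<^bsub>G\<^esub> H" for g x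
    proof -
      obtain k where k: "k \<in> carrier G" "x = k <#\<^bsub>G\<^esub> H" using coset_cases[OF \<open>x \<in> lcosets\<^bsub>G\<^esub> H\<close>] by blast
      then show ?thesis
        using g a \<sigma>G \<rho>0 hom_mult[OF \<sigma>(1)] HG by (simp add: lcos_m_assoc m_assoc)
    qed
    ultimately have R0: "?R \<rho>0"
      by (simp add: real_structure_def equivariant_def X)
    show ?thesis
    proof (rule ex1I[of _ \<rho>0])
      show "\<rho>0 \<in> extensional (topspace (mtop X)) \<and> ?R \<rho>0"
        using R0 by (simp add: \<rho>0_def)
      fix \<rho> assume \<rho>: "\<rho> \<in> extensional (topspace (mtop X)) \<and> ?R \<rho>"
      then have "?R \<rho>" by (rule conjunct2)
      from shape[OF this] obtain b where b: "b \<in> carrier G"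
        "\<sigma> ` H = inner_automorphism G b ` H"
        "\<forall>g\<in>carrier G. \<rho> (g <#\<^bsub>G\<^esub> H) = (\<sigma> g \<otimes>\<^bsub>G\<^esub> b) <#\<^bsub>G\<^esub> H"
        by (elim bexE conjE)
      have "inv\<^bsub>G\<^esub> b \<otimes>\<^bsub>G\<^esub> a \<in> H"
        using conjugate_eq_imp_mem_normalizer[OF HG b(1) a] b(2) conj self_norm by simp
      then have ba: "b <#\<^bsub>G\<^esub> H = a <#\<^bsub>G\<^esub> H" using lcos_eq_iff[OF H b(1) a] by simp
      show "\<rho> = \<rho>0"
      proof (rule extensionalityI[of _ "topspace (mtop X)"])
        fix x assume "x \<in> topspace (mtop X)"
        then obtain g where g: "g \<in> carrier G" "x = g <#\<^bsub>G\<^esub> H" using X coset_cases by auto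
        have "(\<sigma> g \<otimes>\<^bsub>G\<^esub> b) <#\<^bsub>G\<^esub> H = (\<sigma> g \<otimes>\<^bsub>G\<^esub> a) <#\<^bsub>G\<^esub> H"
          using ba lcos_m_assoc[OF HG \<sigma>G[OF g(1)]] a b(1) by metis
        then show "\<rho> x = \<rho>0 x"
          using bspec[OF b(3) g(1)] \<rho>0[OF g(1)] g(2) by simp
      qed (use \<rho> in \<open>simp_all add: \<rho>0_def\<close>)
    qed
  qed
  moreover have "conjugate_by_inner G (\<sigma> ` H) H" if "?R \<rho>" for \<rho>
    using shape[OF that] by (auto simp: conjugate_by_inner_def)
  ultimately show ?thesis by blast
qed

end
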